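(* As $x\to+\infty$, $$\pi(x)\ \geq\ (1+o(1))\,x^{\frac13 H_2\left(\frac{1}{2+\frac23\log_4 3}\right)},$$ that is, there is a function $\varepsilon(x)$ with $\varepsilon(x)\to 0$ as $x\to+\infty$ such that $\pi(x)\geq (1+\varepsilon(x))\,x^{\frac13 H_2\left(1/(2+\frac23\log_4 3)\right)}$ for all sufficiently large real $x$. In particular, $\pi(x)\geq x^{0.3227}$ for all sufficiently large real $x$.
   Context: The Syracuse map $S$ acts on odd positive integers by $S(n)=(3n+1)\,2^{-\mathrm{ord}_2(3n+1)}$, where $\mathrm{ord}_2(m)$ is the exponent of the largest power of $2$ dividing $m$. $S^l$ denotes the $l$-th iterate of $S$ ($S^0$ is the identity). An odd positive integer $n$ is called a Collatz number if $S^l(n)=1$ for some integer $l\geq 0$. For real $x>0$, $\pi(x)=\#\{n\leq x : n \text{ is a Collatz number}\}$. The binary entropy function is $H_2(p)=-p\log_2 p-(1-p)\log_2(1-p)$ for $0<p<1$. *)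

theory Defs
  imports Complex_Main "HOL-Computational_Algebra.Primes"
begin

text \<open>The division is exact, since \<open>2 ^ multiplicity 2 m\<close> divides \<open>m\<close>; only the values at
  odd arguments are meaningful.\<close>

definition syracuse :: "nat \<Rightarrow> nat" where
  "syracuse n = (3 * n + 1) div 2 ^ multiplicity 2 (3 * n + 1)"

definition collatz_number :: "nat \<Rightarrow> bool" where
  "collatz_number n \<longleftrightarrow> odd n \<and> (\<exists>l. (syracuse ^^ l) n = 1)"

definition collatz_count :: "real \<Rightarrow> nat" where
  "collatz_count x = card {n. real n \<le> x \<and> collatz_number n}"

lemma finite_collatz_upto: "finite {n. real n \<le> x \<and> collatz_number n}"
  by (rule finite_subset[of _ "{..nat \<lfloor>x\<rfloor>}"]) (auto simp: le_nat_floor)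

text \<open>Only used for \<open>0 < p < 1\<close>.\<close>

definition binary_entropy :: "real \<Rightarrow> real" where
  "binary_entropy p = - p * log 2 p - (1 - p) * log 2 (1 - p)"

end

theory Submission
  imports Defs "HOL-Real_Asymp.Real_Asymp"
begin

text \<open>
  Since \<open>H\<^sub>2 \<le> 1\<close>, it suffices to show that \<open>\<pi>(x) \<ge> x powr (1/3)\<close> for large \<open>x\<close>.
  We grow the tree of Syracuse preimages of 5. A preimage of \<open>n\<close> is an \<open>m\<close> with
  \<open>3 m + 1 = 2 ^ k n\<close>; here \<open>k\<close> has a fixed parity, and as \<open>k\<close> increases in steps of 2 the residue
  of \<open>m\<close> modulo 3 runs through a cycle of length 3. Hence among the three smallest preimages of an
  \<open>n\<close> prime to 3 exactly two are again prime to 3. Give residue 1 the weight \<open>2 powr (- \<gamma>)\<close> and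
  residue 2 the weight 1. In the worst case these two preimages satisfy
  \<open>\<Sum> w(m) (n/m) powr \<gamma> \<ge> w(n) \<cdot> 3 powr \<gamma> \<cdot> (2 powr (-4\<gamma>) + 2 powr (-5\<gamma>))\<close>, and for \<open>\<gamma> = 0.34\<close> the
  factor exceeds 1. So the number of tree nodes up to \<open>x\<close> is at least a constant times
  \<open>x powr 0.34\<close>.
\<close>

section \<open>The Syracuse map and its backward tree\<close>

lemma multiplicity_two_pow_mult_odd:
  fixes n :: nat
  assumes "odd n"
  shows "multiplicity 2 (2 ^ k * n) = k"
  using assms by (intro multiplicity_eqI) auto

lemma syracuse_eqI:
  assumes "3 * m + 1 = 2 ^ k * n" "odd n"
  shows "syracuse m = n"
  unfolding syracuse_def assms(1) multiplicity_two_pow_mult_odd[OF assms(2)] by simp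

lemma syracuse_1: "syracuse 1 = 1"
  by (rule syracuse_eqI[where k = 2]) auto

lemma syracuse_5: "syracuse 5 = 1"
  by (rule syracuse_eqI[where k = 4]) auto

lemma funpow_syracuse_1: "(syracuse ^^ l) 1 = 1"
  by (induction l) (auto simp: syracuse_1 simp del: One_nat_def)

text \<open>Only the starting point \<open>m\<close> is bounded: its path to \<open>n\<close> may
  exceed \<open>x\<close>. Taking \<open>l = 0\<close> makes an odd \<open>n \<le> x\<close> its own
  ancestor.\<close>

definition ancestors_upto :: "real \<Rightarrow> nat \<Rightarrow> nat set" where
  "ancestors_upto x n = {m. odd m \<and> real m \<le> x \<and> (\<exists>l. (syracuse ^^ l) m = n)}"

lemma finite_ancestors_upto: "finite (ancestors_upto x n)"
  by (rule finite_subset[of _ "{..nat \<lfloor>x\<rfloor>}"]) (auto simp: ancestors_upto_def le_nat_floor)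

text \<open>By time \<open>j * l \<ge> j\<close> the orbit has been absorbed at the fixed point 1,
  yet a period \<open>l\<close> would bring it back to \<open>n\<close>.\<close>

lemma collatz_number_not_periodic:
  assumes "collatz_number n" "n \<noteq> 1" "l > 0"
  shows "(syracuse ^^ l) n \<noteq> n"
proof
  assume per: "(syracuse ^^ l) n = n"
  obtain j where j: "(syracuse ^^ j) n = 1"
    using assms(1) by (auto simp: collatz_number_def)
  have "(syracuse ^^ (i * l)) n = n" for i
    by (induction i) (simp_all add: funpow_add per)
  moreover have "j * l = (j * l - j) + j"
    using assms(3) by simp
  ultimately have "n = (syracuse ^^ (j * l - j)) ((syracuse ^^ j) n)"
    by (metis comp_apply funpow_add)
  with j assms(2) show False
    by (simp add: funpow_syracuse_1 del: One_nat_def)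
qed

lemma collatz_number_preimage:
  assumes "collatz_number n" "syracuse m = n" "odd m"
  shows "collatz_number m"
  using assms unfolding collatz_number_def by (metis comp_apply funpow_Suc_right)

lemma ancestors_upto_preimage:
  assumes "syracuse m = n"
  shows "ancestors_upto x m \<subseteq> ancestors_upto x n"
proof
  fix a assume "a \<in> ancestors_upto x m"
  then obtain l where l: "odd a" "real a \<le> x" "(syracuse ^^ l) a = m"
    by (auto simp: ancestors_upto_def)
  hence "(syracuse ^^ Suc l) a = n"
    using assms by simp
  with l show "a \<in> ancestors_upto x n"
    unfolding ancestors_upto_def by blast
qed

text \<open>Otherwise \<open>n\<close> would be periodic. Losing \<open>n\<close> makes the ancestor
  set shrink strictly, which drives the later induction.\<close>

lemma not_in_ancestors_upto_preimage:
  assumes "collatz_number n" "n \<noteq> 1" "syracuse m = n"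
  shows "n \<notin> ancestors_upto x m"
proof
  assume "n \<in> ancestors_upto x m"
  then obtain l where "(syracuse ^^ l) n = m"
    by (auto simp: ancestors_upto_def)
  hence "(syracuse ^^ Suc l) n = n"
    using assms by simp
  with collatz_number_not_periodic[OF assms(1,2)] show False
    by blast
qed

text \<open>The orbit of a common ancestor would meet one preimage and later the other; since both
  map to \<open>n\<close>, the time between them would be a period of \<open>n\<close>.\<close>

lemma disjoint_ancestors_upto_preimages:
  assumes n: "collatz_number n" "n \<noteq> 1"
    and m: "syracuse m1 = n" "syracuse m2 = n" "m1 \<noteq> m2"
  shows "ancestors_upto x m1 \<inter> ancestors_upto x m2 = {}"
proof -
  have no: False
    if ij: "i \<le> j" "(syracuse ^^ i) a = u" "(syracuse ^^ j) a = v"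
      "syracuse u = n" "syracuse v = n" "u \<noteq> v" for a i j u v
  proof -
    define d where "d = j - i"
    have "j = d + i"
      using ij by (simp add: d_def)
    with ij have d: "(syracuse ^^ d) u = v"
      by (simp add: funpow_add)
    with ij(6) obtain e where e: "d = Suc e"
      by (cases d) auto
    have "(syracuse ^^ Suc e) n = n"
      using d ij(4,5) by (simp add: e funpow_swap1)
    with collatz_number_not_periodic[OF n] show False
      by blast
  qed
  show ?thesis
  proof (rule equals0I)
    fix a assume "a \<in> ancestors_upto x m1 \<inter> ancestors_upto x m2"
    then obtain i j where "(syracuse ^^ i) a = m1" "(syracuse ^^ j) a = m2"
      by (auto simp: ancestors_upto_def)
    with m no[of i j a m1 m2] no[of j i a m2 m1] show False
      by (cases "i \<le> j") auto
  qed
qed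

section \<open>Numerical constants, weights and preimages modulo 9\<close>

definition decay :: real where "decay = 2 powr (- 17/50)"

text \<open>The exponent has denominator 50, so 50th powers reduce the lower bound to rational
  arithmetic. With 0.789 and 1.45 (bounded likewise below),
  \<open>1.45 * (0.789 ^ 4 + 0.789 ^ 5)\<close> is about 1.005, just above 1.\<close>

lemma decay_bounds: "0.789 \<le> decay" "decay \<le> 1"
proof -
  have "decay ^ 50 = 2 powr (- 17)"
    unfolding decay_def by (simp add: powr_power)
  also have "\<dots> = 1 / 2 ^ 17"
    by (simp add: powr_minus_divide)
  finally have p: "decay ^ 50 = 1 / 2 ^ 17" .
  have "(0.789 :: real) ^ 50 \<le> decay ^ 50"
    unfolding p by (simp add: power_divide)
  thus "0.789 \<le> decay"
    by (rule power_le_imp_le_base[where n = 49, simplified]) (simp add: decay_def)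
  show "decay \<le> 1"
    unfolding decay_def using powr_mono[of "- 17/50" 0 "2 :: real"] by simp
qed

lemma three_powr_ge: "1.45 \<le> (3 :: real) powr (17/50)"
proof -
  have "((3 :: real) powr (17/50)) ^ 50 = 3 powr 17"
    by (simp add: powr_power)
  hence p: "((3 :: real) powr (17/50)) ^ 50 = 3 ^ 17"
    by simp
  have "(1.45 :: real) ^ 50 \<le> (3 powr (17/50)) ^ 50"
    unfolding p by (simp add: power_divide)
  thus ?thesis
    by (rule power_le_imp_le_base[where n = 49, simplified]) simp
qed

text \<open>Residue 1 forces even exponents 2, 4, 6 and residue 2 odd ones 1, 3, 5; the factor
  \<open>decay\<close> compensates for the extra doubling.\<close>

definition weight :: "nat \<Rightarrow> real" where
  "weight n = (if n mod 3 = 1 then decay else 1)"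

lemma weight_bounds: "0 \<le> weight n" "weight n \<le> 1"
  using decay_bounds by (auto simp: weight_def)

lemma three_powr_decay_power_ge:
  "1.45 * 0.789 ^ k \<le> 3 powr (17/50) * decay ^ k"
  using three_powr_ge decay_bounds by (intro mult_mono power_mono) auto

text \<open>Raising \<open>k\<close> by 2 sends \<open>m\<close> to \<open>4 * m + 1\<close>, which
  permutes the residues modulo 3 cyclically. So the two preimages kept have residues 1 and 2, and
  \<open>n mod 9\<close> decides their exponents.\<close>

lemma ex_two_preimages:
  assumes n: "odd n" "\<not> 3 dvd n"
  obtains m1 k1 m2 k2 where
    "3 * m1 + 1 = 2 ^ k1 * n" "3 * m2 + 1 = 2 ^ k2 * n"
    "\<not> 3 dvd m1" "\<not> 3 dvd m2" "m1 \<noteq> m2" "k1 \<in> {1..6}" "k2 \<in> {1..6}"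
    "weight n \<le> 3 powr (17/50) * (decay ^ k1 * weight m1 + decay ^ k2 * weight m2)"
proof -
  define q where "q = (3 :: real) powr (17/50)"
  note b = three_powr_decay_power_ge[folded q_def]
  have r: "0 < decay" using decay_bounds by simp
  \<comment> \<open>The three inequalities cover the cases where the multiple of 3 is the smallest
    (\<open>worst\<close>), largest (\<open>A\<close>) or middle (\<open>B\<close>) of the three
    preimages; \<open>scaled\<close> adapts them to residue 1.\<close>
  have worst: "1 \<le> q * (decay ^ 4 + decay ^ 5)"
    using b[of 4] b[of 5] by (simp add: distrib_left power_divide)
  have A: "1 \<le> q * (decay ^ 2 + decay ^ 3)"
    using b[of 2] b[of 3] by (simp add: distrib_left power_divide)
  have B: "1 \<le> q * (decay + decay ^ 6)"
    using b[of 1] b[of 6] by (simp add: distrib_left power_divide)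
  have scaled: "decay \<le> q * (decay * y)" if "1 \<le> q * y" for y
    using mult_left_mono[OF that, of decay] r by (simp add: mult_ac)
  have "(3 * u + 1) mod 3 = 1" "(3 * u + 2) mod 3 = 2" for u :: nat
    by presburger+
  hence w1: "weight (3 * u + 1) = decay" and w2: "weight (3 * u + 2) = 1" for u
    unfolding weight_def by simp_all
  note found = that
  \<comment> \<open>The witnesses below solve \<open>9 * u + 4 = 2 ^ k1 * n\<close> and
    \<open>9 * v + 7 = 2 ^ k2 * n\<close>.\<close>
  have pick: thesis
    if "3 * (3 * u + 1) + 1 = 2 ^ k1 * n" "3 * (3 * v + 2) + 1 = 2 ^ k2 * n"
      "k1 \<in> {1..6}" "k2 \<in> {1..6}"
      "weight n \<le> q * y" "y = decay ^ k1 * decay + decay ^ k2"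
    for u v k1 k2 y
  proof (rule found[OF that(1,2) _ _ _ that(3,4)])
    show "\<not> 3 dvd 3 * u + 1" "\<not> 3 dvd 3 * v + 2" "3 * u + 1 \<noteq> 3 * v + 2"
      by presburger+
    show "weight n \<le> 3 powr (17/50) *
        (decay ^ k1 * weight (3 * u + 1) + decay ^ k2 * weight (3 * v + 2))"
      using that(5) unfolding w1 w2 that(6) q_def by simp
  qed
  define t where "t = n div 9"
  have "n mod 9 \<in> {1, 2, 4, 5, 7, 8}"
    using n(2) by (simp, presburger)
  moreover have "n = 9 * t + n mod 9"
    by (simp add: t_def)
  ultimately consider "n = 3 * (3*t) + 1" | "n = 3 * (3*t) + 2" | "n = 3 * (3*t+1) + 1"
    | "n = 3 * (3*t+1) + 2" | "n = 3 * (3*t+2) + 1" | "n = 3 * (3*t+2) + 2"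
    by fastforce
  then show thesis
  proof cases
    case 1
    have "weight n = decay"
      unfolding 1 by (rule w1)
    then have bound: "weight n \<le> q * (decay * (decay ^ 2 + decay ^ 3))"
      using scaled[OF A] by simp
    show ?thesis
      by (rule pick[OF _ _ _ _ bound, of "4*t" 2 "16*t+1" 4]) (simp_all add: 1, algebra?)
  next
    case 2
    have "weight n = 1"
      unfolding 2 by (rule w2)
    then have bound: "weight n \<le> q * (decay ^ 2 + decay ^ 3)"
      using A by simp
    show ?thesis
      by (rule pick[OF _ _ _ _ bound, of "2*t" 1 "8*t+1" 3]) (simp_all add: 2, algebra?)
  next
    case 3
    have "weight n = decay"
      unfolding 3 by (rule w1)
    then have bound: "weight n \<le> q * (decay * (decay + decay ^ 6))"
      using scaled[OF B] by simp
    show ?thesis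
      by (rule pick[OF _ _ _ _ bound, of "64*t+28" 6 "4*t+1" 2]) (simp_all add: 3, algebra?)
  next
    case 4
    have "weight n = 1"
      unfolding 4 by (rule w2)
    then have bound: "weight n \<le> q * (decay ^ 4 + decay ^ 5)"
      using worst by simp
    show ?thesis
      by (rule pick[OF _ _ _ _ bound, of "8*t+4" 3 "32*t+17" 5]) (simp_all add: 4, algebra?)
  next
    case 5
    have "weight n = decay"
      unfolding 5 by (rule w1)
    then have bound: "weight n \<le> q * (decay * (decay ^ 4 + decay ^ 5))"
      using scaled[OF worst] by simp
    show ?thesis
      by (rule pick[OF _ _ _ _ bound, of "16*t+12" 4 "64*t+49" 6]) (simp_all add: 5, algebra?)
  next
    case 6
    have "weight n = 1"
      unfolding 6 by (rule w2)
    then have bound: "weight n \<le> q * (decay + decay ^ 6)"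
      using B by simp
    show ?thesis
      by (rule pick[OF _ _ _ _ bound, of "32*t+28" 5 "2*t+1" 1]) (simp_all add: 6, algebra?)
  qed
qed

section \<open>Counting tree nodes\<close>

lemma card_ancestors_upto_ge:
  assumes "collatz_number n" "n \<noteq> 1" "\<not> 3 dvd n" "real n \<le> x"
  shows "weight n * (x / n) powr (17/50) / 22 \<le> card (ancestors_upto x n)"
  using assms
proof (induction "card (ancestors_upto x n)" arbitrary: n rule: less_induct)
  case less
  note n = less.prems
  have odd: "odd n" and pos: "n > 0"
    using n(1) by (auto simp: collatz_number_def intro: odd_pos)
  have self: "n \<in> ancestors_upto x n"
    using odd n(4) by (auto simp: ancestors_upto_def intro: exI[of _ 0])
  show ?case
  \<comment> \<open>Exponents are at most 6, so a preimage is at most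
    \<open>64 * n / 3 < 22 * n\<close> and stays below \<open>x\<close> in the second case. In the
    first case the bound is at most 1, and \<open>n\<close> itself suffices.\<close>
  proof (cases "x < 22 * n")
    case True
    have "x / n \<le> 22"
      using True pos by (simp add: field_simps)
    hence "(x / n) powr (17/50) \<le> 22 powr (17/50)"
      using n(4) by (intro powr_mono2) auto
    also have "\<dots> \<le> 22 powr 1"
      by (intro powr_mono) auto
    finally have "(x / n) powr (17/50) \<le> 22" by simp
    hence "weight n * (x / n) powr (17/50) \<le> 1 * 22"
      using weight_bounds by (intro mult_mono) auto
    moreover have "1 \<le> card (ancestors_upto x n)"
      using self finite_ancestors_upto by (metis One_nat_def Suc_leI card_gt_0_iff empty_iff)
    ultimately show ?thesis by simp
  next
    case False
    obtain m1 k1 m2 k2 where m: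
      "3 * m1 + 1 = 2 ^ k1 * n" "3 * m2 + 1 = 2 ^ k2 * n"
      "\<not> 3 dvd m1" "\<not> 3 dvd m2" "m1 \<noteq> m2" "k1 \<in> {1..6}" "k2 \<in> {1..6}"
      "weight n \<le> 3 powr (17/50) * (decay ^ k1 * weight m1 + decay ^ k2 * weight m2)"
      using ex_two_preimages[OF odd n(3)] .
    have child: "ancestors_upto x m \<subseteq> ancestors_upto x n - {n} \<and> syracuse m = n \<and>
        3 powr (17/50) * decay ^ k * weight m * (x / n) powr (17/50) / 22
          \<le> card (ancestors_upto x m)"
      if m: "3 * m + 1 = 2 ^ k * n" "\<not> 3 dvd m" "k \<in> {1..6}" for m k
    proof -
      have S: "syracuse m = n"
        using syracuse_eqI[OF m(1) odd] .
      have "even (3 * m + 1)"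
        using m(1,3) by simp
      hence "odd m" by simp
      hence "m > 0" by (rule odd_pos)
      have C: "collatz_number m"
        using collatz_number_preimage[OF n(1) S \<open>odd m\<close>] .
      have "m \<noteq> 1"
        using S n(2) syracuse_1 by blast
      have sub: "ancestors_upto x m \<subseteq> ancestors_upto x n - {n}"
        using ancestors_upto_preimage[OF S] not_in_ancestors_upto_preimage[OF n(1,2) S] by blast
      hence less_card: "card (ancestors_upto x m) < card (ancestors_upto x n)"
        using self by (intro psubset_card_mono finite_ancestors_upto) blast
      have le: "3 * real m \<le> 2 ^ k * real n"
      proof -
        have "real (3 * m + 1) = real (2 ^ k * n)"
          by (simp only: m(1))
        thus ?thesis by simp
      qed
      have "(2 :: real) ^ k \<le> 2 ^ 6"
        using m(3) by (intro power_increasing) auto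
      hence "2 ^ k * real n \<le> 64 * real n"
        by (intro mult_right_mono) auto
      with le False have "real m \<le> x" by linarith
      have xp: "x > 0"
        using pos n(4) by linarith
      \<comment> \<open>Raised to the power 17/50, this yields the factor
        \<open>3 powr (17/50) * decay ^ k\<close> of the preimage lemma.\<close>
      have "3 * (1 / 2) ^ k * (x / n) \<le> x / m"
        using le mult_right_mono[OF le, of x] pos \<open>m > 0\<close> xp by (simp add: field_simps)
      hence "(3 * (1 / 2) ^ k * (x / n)) powr (17/50) \<le> (x / m) powr (17/50)"
        using xp by (intro powr_mono2) auto
      moreover have "((1 / 2 :: real) ^ k) powr (17/50) = decay ^ k"
      proof -
        have "((1 / 2 :: real) ^ k) powr (17/50) = ((1/2) powr (17/50)) ^ k"
          by (simp add: powr_power powr_powr mult.commute flip: powr_realpow)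
        also have "(1 / 2 :: real) powr (17/50) = decay"
          by (simp add: decay_def powr_divide powr_minus_divide)
        finally show ?thesis .
      qed
      ultimately have "3 powr (17/50) * decay ^ k * (x / n) powr (17/50) \<le> (x / m) powr (17/50)"
        using xp by (simp add: powr_mult del: times_divide_eq_right)
      hence "weight m * (3 powr (17/50) * decay ^ k * (x / n) powr (17/50))
          \<le> weight m * (x / m) powr (17/50)"
        using weight_bounds by (intro mult_left_mono) auto
      also have "\<dots> / 22 \<le> card (ancestors_upto x m)"
        using less.hyps[OF less_card C \<open>m \<noteq> 1\<close> m(2) \<open>real m \<le> x\<close>] .
      finally show ?thesis
        using sub S by (simp add: mult_ac)
    qed
    note c1 = child[OF m(1,3,6)] and c2 = child[OF m(2,4,7)]
    let ?y = "(x / n) powr (17/50)"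
    have "weight n * ?y / 22
        \<le> 3 powr (17/50) * (decay ^ k1 * weight m1 + decay ^ k2 * weight m2) * ?y / 22"
      using m(8) by (intro divide_right_mono mult_right_mono) auto
    also have "\<dots> = 3 powr (17/50) * decay ^ k1 * weight m1 * ?y / 22
        + 3 powr (17/50) * decay ^ k2 * weight m2 * ?y / 22"
      by (simp add: algebra_simps)
    also have "\<dots> \<le> card (ancestors_upto x m1) + card (ancestors_upto x m2)"
      using c1 c2 by simp
    also have "card (ancestors_upto x m1) + card (ancestors_upto x m2)
        = card (ancestors_upto x m1 \<union> ancestors_upto x m2)"
      using disjoint_ancestors_upto_preimages[OF n(1,2)] c1 c2 m(5)
      by (intro card_Un_disjoint[symmetric] finite_ancestors_upto) blast
    also have "\<dots> \<le> card (ancestors_upto x n)"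
      using c1 c2 by (intro card_mono finite_ancestors_upto) blast
    finally show ?thesis by simp
  qed
qed

section \<open>From the tree to the asymptotic bounds\<close>

lemma collatz_number_5: "collatz_number 5"
  unfolding collatz_number_def using syracuse_5 by (auto intro: exI[of _ 1])

text \<open>The root is 5 because 1 is its own preimage, which breaks disjointness; 5 maps to 1 and
  is prime to 3.\<close>

lemma collatz_count_ge:
  assumes "x \<ge> 5"
  shows "(x / 5) powr (17/50) / 22 \<le> collatz_count x"
proof -
  have "(x / 5) powr (17/50) / 22 \<le> card (ancestors_upto x 5)"
    using card_ancestors_upto_ge[OF collatz_number_5, of x] assms by (simp add: weight_def)
  also have "ancestors_upto x 5 \<subseteq> {n. real n \<le> x \<and> collatz_number n}"
  proof
    fix m assume "m \<in> ancestors_upto x 5"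
    then obtain l where l: "odd m" "real m \<le> x" "(syracuse ^^ l) m = 5"
      by (auto simp: ancestors_upto_def)
    hence "(syracuse ^^ Suc l) m = 1"
      using syracuse_5 by simp
    with l show "m \<in> {n. real n \<le> x \<and> collatz_number n}"
      unfolding collatz_number_def by blast
  qed
  hence "card (ancestors_upto x 5) \<le> collatz_count x"
    unfolding collatz_count_def by (intro card_mono finite_collatz_upto)
  finally show ?thesis by simp
qed

text \<open>Since 1/3 < 17/50, the gap in the exponents absorbs the constants 5 and 22.\<close>

lemma eventually_collatz_count_ge:
  assumes "c \<le> 1/3"
  shows "\<forall>\<^sub>F x in at_top. x powr c \<le> collatz_count x"
proof -
  have "\<forall>\<^sub>F x :: real in at_top. x powr (1/3) \<le> (x / 5) powr (17/50) / 22"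
    by real_asymp
  with eventually_ge_at_top[of 5] show ?thesis
  proof eventually_elim
    case (elim x)
    have "x powr c \<le> x powr (1/3)"
      using assms elim by (intro powr_mono) auto
    with elim collatz_count_ge[of x] show ?case by linarith
  qed
qed

text \<open>Gibbs' inequality against the uniform distribution on two points: the right-hand sides
  of \<open>gibbs\<close> at \<open>p\<close> and \<open>1 - p\<close> sum to 0.\<close>

lemma binary_entropy_le_1:
  assumes "0 < p" "p < 1"
  shows "binary_entropy p \<le> 1"
proof -
  have gibbs: "q * (- ln 2 - ln q) \<le> 1/2 - q" if "0 < q" for q :: real
  proof -
    have "ln (1 / (2 * q)) \<le> 1 / (2 * q) - 1"
      using that by (intro ln_le_minus_one) simp
    moreover have "ln (1 / (2 * q)) = - ln 2 - ln q"
      using that by (simp add: ln_div ln_mult_pos)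
    ultimately have "q * (- ln 2 - ln q) \<le> q * (1 / (2 * q) - 1)"
      using that by simp
    thus ?thesis
      using that by (simp add: right_diff_distrib)
  qed
  have "- p * ln p - (1 - p) * ln (1 - p) \<le> ln 2"
    using gibbs[of p] gibbs[of "1 - p"] assms by (simp add: algebra_simps)
  thus ?thesis
    by (simp add: binary_entropy_def log_def field_simps)
qed

theorem theorem1p5:
  shows "(\<exists>\<epsilon> :: real \<Rightarrow> real. (\<epsilon> \<longlongrightarrow> 0) at_top \<and>
           (\<forall>\<^sub>F x in at_top. real (collatz_count x) \<ge>
              (1 + \<epsilon> x) * x powr ((1/3) * binary_entropy (1 / (2 + (2/3) * log 4 3)))))
       \<and> (\<forall>\<^sub>F x in at_top. real (collatz_count x) \<ge> x powr 0.3227)"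
\<comment> \<open>The exponent 1/3 dominates the entropy exponent, so the error term can be
  identically 0.\<close>
proof (intro conjI exI[of _ "\<lambda>_. 0"])
  have "log 4 3 > (0 :: real)" by simp
  hence "binary_entropy (1 / (2 + (2/3) * log 4 3)) \<le> 1"
    by (intro binary_entropy_le_1) (auto simp: field_simps add_pos_pos)
  hence "(1/3) * binary_entropy (1 / (2 + (2/3) * log 4 3)) \<le> 1/3" by simp
  from eventually_collatz_count_ge[OF this]
  show "\<forall>\<^sub>F x in at_top. real (collatz_count x) \<ge>
      (1 + 0) * x powr ((1/3) * binary_entropy (1 / (2 + (2/3) * log 4 3)))" by simp
  show "\<forall>\<^sub>F x in at_top. real (collatz_count x) \<ge> x powr 0.3227"
    by (rule eventually_collatz_count_ge) simp
qed simp

end
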